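(* Let $(M,\omega)$ be a closed surface with an area form and let $\eta\colon C(M)\to\mathbb{R}$ be a quasi-state. Then $\eta$ is linear on Poisson commuting subspaces of $C(M)$; that is, if $V\subset C(M)$ is a linear subspace any two elements of which Poisson commute, then the restriction $\eta|_V$ is linear.
   Context: A closed surface is a compact two-dimensional smooth manifold without boundary; an area form is a nowhere vanishing 2-form. For a compact Hausdorff space $Z$, $C(Z)$ denotes the Banach algebra of all real-valued continuous functions on $Z$ (with the uniform norm $\|F\|=\sup_{Z}|F|$). For $F\in C(Z)$ let $C(F)=\{\phi\circ F \mid \phi\in C(\operatorname{im}F)\}$, the closed subalgebra of $C(Z)$ generated by $F$. Quasi-state: a (not necessarily linear) functional $\eta\colon C(Z)\to\mathbb{R}$ is called a quasi-state if (i) $\eta(1)=1$; (ii) $\eta(F)\geq 0$ for $F\geq 0$; (iii) for each $F\in C(Z)$ the restriction $\eta|_{C(F)}$ is linear. Poisson bracket: for $F,G\in C^\infty(M)$ on a surface with area form $\omega$, $\{F,G\}\in C^\infty(M)$ is defined by $\{F,G\}\,\omega=dF\wedge dG$. Poisson commuting continuous functions: $F,G\in C(M)$ are said to Poisson commute if there are $F_k,G_k\in C^\infty(M)$, $k\in\mathbb{N}$, such that $F_k\to F$, $G_k\to G$ and $\{F_k,G_k\}\to 0$ as $k\to\infty$, all in the uniform norm. *)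

theory Defs
  imports "HOL-Analysis.Analysis"
begin

section \<open>Smooth surfaces\<close>

text \<open>\<open>C_k_on k S f\<close> is meant for open \<open>S\<close> and a finite-dimensional domain, where it says that all
  iterated directional (equivalently, partial) derivatives of \<open>f\<close> of order at most \<open>k\<close> exist and
  are continuous on \<open>S\<close>.\<close>

fun C_k_on :: "nat \<Rightarrow> 'a::real_normed_vector set \<Rightarrow> ('a \<Rightarrow> 'b::real_normed_vector) \<Rightarrow> bool" where
  "C_k_on 0 S f \<longleftrightarrow> continuous_on S f"
| "C_k_on (Suc k) S f \<longleftrightarrow>
     (\<forall>x\<in>S. f differentiable (at x)) \<and> (\<forall>v. C_k_on k S (\<lambda>x. frechet_derivative f (at x) v))"

definition smooth_on :: "'a::real_normed_vector set \<Rightarrow> ('a \<Rightarrow> 'b::real_normed_vector) \<Rightarrow> bool" where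
  "smooth_on S f \<longleftrightarrow> (\<forall>k. C_k_on k S f)"

text \<open>A surface is carried by a whole type. A chart \<open>(U, \<phi>)\<close> consists of its domain \<open>U\<close> and a map
  whose values outside \<open>U\<close> are irrelevant.\<close>

type_synonym 'a chart = "'a set \<times> ('a \<Rightarrow> real^2)"

abbreviation dom_chart :: "'a chart \<Rightarrow> 'a set" where
  "dom_chart c \<equiv> fst c"

abbreviation coord :: "'a chart \<Rightarrow> 'a \<Rightarrow> real^2" where
  "coord c \<equiv> snd c"

definition inv_coord :: "'a chart \<Rightarrow> real^2 \<Rightarrow> 'a" where
  "inv_coord c = inv_into (dom_chart c) (coord c)"

definition is_chart :: "'a::topological_space chart \<Rightarrow> bool" where
  "is_chart c \<longleftrightarrow> open (dom_chart c) \<and> open (coord c ` dom_chart c) \<and>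
     homeomorphism (dom_chart c) (coord c ` dom_chart c) (coord c) (inv_coord c)"

definition transition :: "'a chart \<Rightarrow> 'a chart \<Rightarrow> real^2 \<Rightarrow> real^2" where
  "transition c d = coord d \<circ> inv_coord c"

definition smooth_atlas :: "'a::topological_space chart set \<Rightarrow> bool" where
  "smooth_atlas A \<longleftrightarrow> (\<forall>c\<in>A. is_chart c) \<and> (\<Union>c\<in>A. dom_chart c) = UNIV \<and>
     (\<forall>c\<in>A. \<forall>d\<in>A. smooth_on (coord c ` (dom_chart c \<inter> dom_chart d)) (transition c d))"

text \<open>The smooth structure is given by an arbitrary smooth atlas, not necessarily maximal. Second
  countability is automatic by compactness. Connectedness is not required.\<close>

definition closed_surface :: "'a::t2_space chart set \<Rightarrow> bool" where
  "closed_surface A \<longleftrightarrow> compact (UNIV :: 'a set) \<and> smooth_atlas A"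

definition smooth_fun :: "'a::topological_space chart set \<Rightarrow> ('a \<Rightarrow> real) \<Rightarrow> bool" where
  "smooth_fun A F \<longleftrightarrow> (\<forall>c\<in>A. smooth_on (coord c ` dom_chart c) (F \<circ> inv_coord c))"


section \<open>Area forms and the Poisson bracket\<close>

text \<open>A tangent vector at \<open>p\<close> is represented, relative to a chart \<open>c\<close> around \<open>p\<close>, by its coordinate
  vector in \<open>real^2\<close>; the representation relative to another chart \<open>d\<close> is obtained by applying the
  derivative of the transition map \<open>transition c d\<close> at \<open>coord c p\<close>. Accordingly, \<open>\<omega> c p u v\<close> below
  is the value of the form \<open>\<omega>\<close> at \<open>p\<close> on the two tangent vectors represented in \<open>c\<close> by \<open>u\<close> and \<open>v\<close>;
  it is relevant only for \<open>p \<in> dom_chart c\<close>.\<close>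

type_synonym 'a form1 = "'a chart \<Rightarrow> 'a \<Rightarrow> real^2 \<Rightarrow> real"
type_synonym 'a form2 = "'a chart \<Rightarrow> 'a \<Rightarrow> real^2 \<Rightarrow> real^2 \<Rightarrow> real"

definition two_form :: "'a::topological_space chart set \<Rightarrow> 'a form2 \<Rightarrow> bool" where
  "two_form A \<omega> \<longleftrightarrow>
     (\<forall>c\<in>A. \<forall>p\<in>dom_chart c. bilinear (\<omega> c p) \<and> (\<forall>u. \<omega> c p u u = 0)) \<and>
     (\<forall>c\<in>A. \<forall>d\<in>A. \<forall>p\<in>dom_chart c \<inter> dom_chart d. \<forall>u v.
        \<omega> c p u v = \<omega> d p (frechet_derivative (transition c d) (at (coord c p)) u)
                          (frechet_derivative (transition c d) (at (coord c p)) v)) \<and>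
     (\<forall>c\<in>A. \<forall>u v. smooth_on (coord c ` dom_chart c) (\<lambda>x. \<omega> c (inv_coord c x) u v))"

definition area_form :: "'a::topological_space chart set \<Rightarrow> 'a form2 \<Rightarrow> bool" where
  "area_form A \<omega> \<longleftrightarrow> two_form A \<omega> \<and> (\<forall>c\<in>A. \<forall>p\<in>dom_chart c. \<exists>u v. \<omega> c p u v \<noteq> 0)"

definition differential :: "('a \<Rightarrow> real) \<Rightarrow> 'a form1" where
  "differential F c p u = frechet_derivative (F \<circ> inv_coord c) (at (coord c p)) u"

definition wedge :: "'a form1 \<Rightarrow> 'a form1 \<Rightarrow> 'a form2" where
  "wedge \<alpha> \<beta> c p u v = \<alpha> c p u * \<beta> c p v - \<alpha> c p v * \<beta> c p u"

definition poisson_bracket ::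
    "'a::topological_space chart set \<Rightarrow> 'a form2 \<Rightarrow> ('a \<Rightarrow> real) \<Rightarrow> ('a \<Rightarrow> real) \<Rightarrow> 'a \<Rightarrow> real" where
  "poisson_bracket A \<omega> F G p =
     (THE h. \<forall>c\<in>A. p \<in> dom_chart c \<longrightarrow>
        (\<forall>u v. h * \<omega> c p u v = wedge (differential F) (differential G) c p u v))"


section \<open>Quasi-states\<close>

text \<open>On a compact space every continuous function is bounded, so the type \<open>'z \<Rightarrow>\<^sub>C real\<close> is \<open>C(Z)\<close>
  with the uniform norm.\<close>

definition linear_on :: "'v::real_vector set \<Rightarrow> ('v \<Rightarrow> real) \<Rightarrow> bool" where
  "linear_on V \<eta> \<longleftrightarrow> (\<forall>x\<in>V. \<forall>y\<in>V. \<eta> (x + y) = \<eta> x + \<eta> y) \<and> (\<forall>a. \<forall>x\<in>V. \<eta> (a *\<^sub>R x) = a * \<eta> x)"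

definition generated_subalgebra :: "('z::topological_space \<Rightarrow>\<^sub>C real) \<Rightarrow> ('z \<Rightarrow>\<^sub>C real) set" where
  "generated_subalgebra F =
     {H. \<exists>\<phi>. continuous_on (range (apply_bcontfun F)) \<phi> \<and> apply_bcontfun H = \<phi> \<circ> apply_bcontfun F}"

definition quasi_state :: "(('z::topological_space \<Rightarrow>\<^sub>C real) \<Rightarrow> real) \<Rightarrow> bool" where
  "quasi_state \<eta> \<longleftrightarrow>
     \<eta> (const_bcontfun 1) = 1 \<and>
     (\<forall>F. (\<forall>z. apply_bcontfun F z \<ge> 0) \<longrightarrow> \<eta> F \<ge> 0) \<and>
     (\<forall>F. linear_on (generated_subalgebra F) \<eta>)"


section \<open>Poisson commuting continuous functions\<close>

definition poisson_commute ::
    "'a::topological_space chart set \<Rightarrow> 'a form2 \<Rightarrow> ('a \<Rightarrow>\<^sub>C real) \<Rightarrow> ('a \<Rightarrow>\<^sub>C real) \<Rightarrow> bool" where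
  "poisson_commute A \<omega> F G \<longleftrightarrow>
     (\<exists>Fs Gs :: nat \<Rightarrow> 'a \<Rightarrow>\<^sub>C real.
        (\<forall>k. smooth_fun A (apply_bcontfun (Fs k))) \<and> (\<forall>k. smooth_fun A (apply_bcontfun (Gs k))) \<and>
        Fs \<longlonglongrightarrow> F \<and> Gs \<longlonglongrightarrow> G \<and>
        uniform_limit UNIV
          (\<lambda>k. poisson_bracket A \<omega> (apply_bcontfun (Fs k)) (apply_bcontfun (Gs k)))
          (\<lambda>_. 0) sequentially)"


section \<open>The Poisson bracket is well defined\<close>

lemma smooth_on_differentiable: "smooth_on S f \<Longrightarrow> x \<in> S \<Longrightarrow> f differentiable (at x)"
  unfolding smooth_on_def by (metis C_k_on.simps(2))

lemma alternating_bilinear_real2: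
  fixes B :: "real^2 \<Rightarrow> real^2 \<Rightarrow> real"
  assumes "bilinear B" "\<And>u. B u u = 0"
  shows "B u v = (u$1 * v$2 - u$2 * v$1) * B (axis 1 1) (axis 2 1)"
proof -
  let ?e = "axis 1 1 :: real^2" and ?f = "axis 2 1 :: real^2"
  have e: "w = w$1 *\<^sub>R ?e + w$2 *\<^sub>R ?f" for w :: "real^2"
    by (simp add: vec_eq_iff forall_2 axis_def)
  have "B ?e ?e + B ?f ?e + (B ?e ?f + B ?f ?f) = 0"
    using assms(2)[of "?e + ?f"] unfolding bilinear_ladd[OF assms(1)] bilinear_radd[OF assms(1)] .
  then have sw: "B ?f ?e = - B ?e ?f"
    using assms(2)[of ?e] assms(2)[of ?f] by linarith
  have "B u v = B (u$1 *\<^sub>R ?e + u$2 *\<^sub>R ?f) (v$1 *\<^sub>R ?e + v$2 *\<^sub>R ?f)"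
    using e[of u] e[of v] by simp
  also have "\<dots> = (u$1 * v$2 - u$2 * v$1) * B ?e ?f"
    by (simp add: bilinear_ladd[OF assms(1)] bilinear_radd[OF assms(1)] bilinear_lmul[OF assms(1)]
        bilinear_rmul[OF assms(1)] assms(2) sw algebra_simps)
  finally show ?thesis .
qed

lemma differential_transition:
  assumes A: "smooth_atlas A" and F: "smooth_fun A F"
    and c: "c \<in> A" "p \<in> dom_chart c" and d: "d \<in> A" "p \<in> dom_chart d"
  shows "differential F c p u =
           differential F d p (frechet_derivative (transition c d) (at (coord c p)) u)"
proof -
  let ?x = "coord c p" and ?W = "coord c ` (dom_chart c \<inter> dom_chart d)"
  have ch: "is_chart c" "is_chart d" using A c d by (auto simp: smooth_atlas_def)
  have invc: "inv_coord c (coord c q) = q" if "q \<in> dom_chart c" for q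
    using ch(1) that by (auto simp: is_chart_def homeomorphism_def)
  have invd: "inv_coord d (coord d q) = q" if "q \<in> dom_chart d" for q
    using ch(2) that by (auto simp: is_chart_def homeomorphism_def)
  have x: "?x \<in> ?W" using c d by auto
  have "openin (top_of_set (coord c ` dom_chart c)) ?W"
    using ch by (intro homeomorphism_imp_open_map[of "dom_chart c" _ _ "inv_coord c"])
      (auto simp: is_chart_def intro: openin_open_Int)
  then have W: "open ?W" using ch(1) by (auto simp: is_chart_def intro: openin_open_trans)
  have t: "(transition c d) differentiable (at ?x)"
    using A c d x by (intro smooth_on_differentiable[of ?W]) (auto simp: smooth_atlas_def)
  have tx: "transition c d ?x = coord d p" using invc c by (simp add: transition_def)
  have Fd: "(F \<circ> inv_coord d) differentiable (at (transition c d ?x))"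
    using F d unfolding tx smooth_fun_def
    by (intro smooth_on_differentiable[of "coord d ` dom_chart d"]) auto
  let ?D = "\<lambda>v. frechet_derivative (F \<circ> inv_coord d) (at (transition c d ?x))
                  (frechet_derivative (transition c d) (at ?x) v)"
  have "((F \<circ> inv_coord d) \<circ> transition c d has_derivative ?D) (at ?x)"
    using diff_chain_at[OF frechet_derivative_works[THEN iffD1, OF t] frechet_derivative_works[THEN iffD1, OF Fd]]
    by (simp add: o_def)
  moreover have "((F \<circ> inv_coord d) \<circ> transition c d) y = (F \<circ> inv_coord c) y" if "y \<in> ?W" for y
    using that by (auto simp: transition_def invc invd)
  ultimately have "(F \<circ> inv_coord c has_derivative ?D) (at ?x)"
    using has_derivative_transform_within_open[OF _ W x] by blast
  then have "frechet_derivative (F \<circ> inv_coord c) (at ?x) = ?D"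
    using frechet_derivative_at by metis
  then show ?thesis by (simp add: differential_def tx)
qed

lemma linear_differential:
  assumes "smooth_fun A F" "c \<in> A" "p \<in> dom_chart c"
  shows "linear (differential F c p)"
proof -
  have "(F \<circ> inv_coord c) differentiable (at (coord c p))"
    using assms by (intro smooth_on_differentiable[of "coord c ` dom_chart c"]) (auto simp: smooth_fun_def)
  then show ?thesis
    using linear_frechet_derivative by (metis (no_types, lifting) differential_def ext)
qed

lemma poisson_bracket_ex1:
  assumes A: "smooth_atlas A" and \<omega>: "area_form A \<omega>" and F: "smooth_fun A F" and G: "smooth_fun A G"
  shows "\<exists>!h. \<forall>c\<in>A. p \<in> dom_chart c \<longrightarrow>
           (\<forall>u v. h * \<omega> c p u v = wedge (differential F) (differential G) c p u v)"
proof -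
  let ?w = "wedge (differential F) (differential G)"
  obtain c where c: "c \<in> A" "p \<in> dom_chart c" using A unfolding smooth_atlas_def by blast
  let ?o = "\<omega> c p (axis 1 1) (axis 2 1)"
  have o: "\<omega> c p u v = (u$1 * v$2 - u$2 * v$1) * ?o" for u v
    using \<omega> c unfolding area_form_def two_form_def
    by (intro alternating_bilinear_real2[of "\<omega> c p"]) auto
  have o0: "?o \<noteq> 0" using \<omega> c o unfolding area_form_def by (metis mult_zero_right)
  have dF: "linear (differential F c p)" and dG: "linear (differential G c p)"
    using linear_differential F G c by blast+
  have "bilinear (?w c p)"
    unfolding bilinear_def wedge_def
    by (auto intro!: linearI simp: linear_add[OF dF] linear_add[OF dG] linear_scale[OF dF]
        linear_scale[OF dG] algebra_simps)
  then have w: "?w c p u v = (u$1 * v$2 - u$2 * v$1) * ?w c p (axis 1 1) (axis 2 1)" for u v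
    by (intro alternating_bilinear_real2[of "?w c p"]) (auto simp: wedge_def)
  show ?thesis
  proof (rule ex1I[of _ "?w c p (axis 1 1) (axis 2 1) / ?o"], intro ballI impI allI)
    fix d u v assume d: "d \<in> A" "p \<in> dom_chart d"
    let ?T = "frechet_derivative (transition d c) (at (coord d p))"
    have "\<omega> d p u v = \<omega> c p (?T u) (?T v)"
      using \<omega> c d unfolding area_form_def two_form_def by blast
    moreover have "?w d p u v = ?w c p (?T u) (?T v)"
      using differential_transition[OF A F d c] differential_transition[OF A G d c]
      by (simp add: wedge_def)
    ultimately show "?w c p (axis 1 1) (axis 2 1) / ?o * \<omega> d p u v = ?w d p u v"
      using o[of "?T u" "?T v"] w[of "?T u" "?T v"] o0 by simp
  next
    fix h assume "\<forall>c\<in>A. p \<in> dom_chart c \<longrightarrow> (\<forall>u v. h * \<omega> c p u v = ?w c p u v)"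
    then have "h * ?o = ?w c p (axis 1 1) (axis 2 1)" using c by blast
    then show "h = ?w c p (axis 1 1) (axis 2 1) / ?o" using o0 by (simp add: field_simps)
  qed
qed

lemma poisson_bracket:
  assumes "smooth_atlas A" "area_form A \<omega>" "smooth_fun A F" "smooth_fun A G"
    and "c \<in> A" "p \<in> dom_chart c"
  shows "poisson_bracket A \<omega> F G p * \<omega> c p u v = wedge (differential F) (differential G) c p u v"
  using theI'[OF poisson_bracket_ex1[OF assms(1-4), of p]] assms(5,6)
  unfolding poisson_bracket_def by blast

end

theory Submission
  imports Defs
begin

text \<open>A small bracket forces the image of \<open>(F, G) : M \<rightarrow> \<real>\<^sup>2\<close> to have small area, since the Jacobian of
  \<open>(F, G)\<close> in a chart is the bracket times the density of \<open>\<omega>\<close>. An image of small area avoids some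
  translate of the lattice \<open>s\<int>\<^sup>2\<close>, whose complement looks one-dimensional at scale \<open>s\<close>: up to an
  arbitrarily small \<open>\<eta>\<close>-mass, the pulled back pieces carry a disjointly supported family of functions,
  on the supports of which \<open>F\<close> and \<open>G\<close> are constant up to \<open>s\<close>. On such step functions \<open>\<eta>\<close> is linear,
  and monotonicity of \<open>\<eta>\<close> bounds the additivity defect of \<open>(F, G)\<close> by a multiple of \<open>s\<close>.\<close>

section \<open>Quasi-states on a compact space\<close>

text \<open>For \<open>t \<ge> 0\<close>, the length of the part of \<open>[0, t]\<close> that lies
  between the levels \<open>i * d\<close> and \<open>(i + 1) * d\<close>.\<close>

definition layer :: "real \<Rightarrow> nat \<Rightarrow> real \<Rightarrow> real" where
  "layer d i t = max 0 (min (t - real i * d) d)"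

lemma continuous_layer: "continuous_on UNIV (layer d i)"
  unfolding layer_def by (intro continuous_intros)

lemma sum_layer:
  assumes "0 \<le> t" "0 < d"
  shows "(\<Sum>i<n. layer d i t) = min t (real n * d)"
  using assms by (induction n) (auto simp: layer_def algebra_simps min_def max_def)

text \<open>At most one \<open>f i\<close> is nonzero, so a bound on the surviving term bounds the
  sum; \<open>0 \<le> v\<close> covers the case that none survives.\<close>

lemma disjoint_sum_le:
  fixes f m :: "'i \<Rightarrow> real"
  assumes "finite I" "0 \<le> v"
    and disj: "\<And>i j. i \<in> I \<Longrightarrow> j \<in> I \<Longrightarrow> i \<noteq> j \<Longrightarrow> f i * f j = 0"
    and le: "\<And>i. i \<in> I \<Longrightarrow> f i \<noteq> 0 \<Longrightarrow> m i * f i \<le> v"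
  shows "(\<Sum>i\<in>I. m i * f i) \<le> v"
proof (cases "\<exists>i\<in>I. f i \<noteq> 0")
  case True
  then obtain i where i: "i \<in> I" "f i \<noteq> 0" by blast
  then have "f j = 0" if "j \<in> I - {i}" for j using disj[of i j] that by auto
  then have "(\<Sum>i\<in>I. m i * f i) = m i * f i"
    using i assms(1) by (simp add: sum.remove)
  then show ?thesis using le i by simp
next
  case False
  then show ?thesis using assms(2) by simp
qed

text \<open>Cutting \<open>f\<close> down to \<open>U i\<close> creates no jump: off the other
  pieces the result is \<open>f\<close>, off \<open>U i\<close> it is 0, and by disjointness these
  two closed sets cover the space.\<close>

lemma continuous_on_restrict_piece:
  fixes f :: "'a::topological_space \<Rightarrow> real"
  assumes f: "continuous_on UNIV f" and opn: "\<And>j. j \<in> J \<Longrightarrow> open (U j)"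
    and disj: "\<And>j k. j \<in> J \<Longrightarrow> k \<in> J \<Longrightarrow> j \<noteq> k \<Longrightarrow> U j \<inter> U k = {}"
    and cover: "\<And>p. f p \<noteq> 0 \<Longrightarrow> \<exists>j\<in>J. p \<in> U j" and i: "i \<in> J"
  shows "continuous_on UNIV (\<lambda>p. if p \<in> U i then f p else 0)"
proof -
  let ?S = "- (\<Union>j\<in>J - {i}. U j)" and ?T = "- U i"
  let ?g = "\<lambda>p. if p \<in> U i then f p else 0"
  have "continuous_on (?S \<union> ?T) ?g"
  proof (rule continuous_on_closed_Un)
    show "closed ?S" "closed ?T" using opn i by auto
    have "?g p = f p" if "p \<in> ?S" for p using that cover[of p] by auto
    then show "continuous_on ?S ?g"
      using continuous_on_subset[OF f, of ?S] continuous_on_cong[OF refl, of ?S ?g f] by blast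
    show "continuous_on ?T ?g"
      using continuous_on_cong[OF refl, of ?T ?g "\<lambda>_. 0"] by simp
  qed
  moreover have "?S \<union> ?T = UNIV" using disj[OF i] by blast
  ultimately show ?thesis by simp
qed

definition ramp :: "real \<Rightarrow> real" where
  "ramp t = max 0 (min 1 t)"

lemma continuous_on_ramp [continuous_intros]:
  "continuous_on S f \<Longrightarrow> continuous_on S (\<lambda>p. ramp (f p))"
  unfolding ramp_def by (intro continuous_intros)

section \<open>Linearity on functions of one function\<close>

locale compact_quasi_state =
  fixes \<eta> :: "('a::t2_space \<Rightarrow>\<^sub>C real) \<Rightarrow> real"
  assumes compact_space: "compact (UNIV :: 'a set)"
    and qs: "quasi_state \<eta>"
begin

text \<open>This lets \<open>\<eta>\<close> act on plain functions; only continuous arguments are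
  meaningful.\<close>

definition E :: "('a \<Rightarrow> real) \<Rightarrow> real" where
  "E f = \<eta> (Bcontfun f)"

lemma apply_Bcontfun:
  assumes "continuous_on UNIV f"
  shows "apply_bcontfun (Bcontfun f) = (f :: 'a \<Rightarrow> real)"
  using assms compact_continuous_image[OF assms compact_space]
  by (intro Bcontfun_inverse) (auto simp: bcontfun_def compact_imp_bounded)

lemma E_apply_bcontfun: "E (apply_bcontfun F) = \<eta> F"
  by (simp add: E_def apply_bcontfun_inverse)

lemma E_const: "E (\<lambda>_. 1) = 1"
  using qs by (simp add: quasi_state_def E_def const_bcontfun_def)

lemma E_nonneg:
  assumes "continuous_on UNIV f" "\<And>p. 0 \<le> f p"
  shows "0 \<le> E f"
  using qs assms by (simp add: quasi_state_def E_def apply_Bcontfun)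

text \<open>The linearity axiom of quasi-states enters here. Later additivity proofs therefore look
  for one \<open>h\<close> through which all functions in question factor.\<close>

lemma linear_on_comp:
  fixes h :: "'a \<Rightarrow> real" and \<phi> \<psi> :: "real \<Rightarrow> real"
  assumes h: "continuous_on UNIV h" and "continuous_on UNIV \<phi>" "continuous_on UNIV \<psi>"
  shows E_add_comp: "E (\<lambda>p. \<phi> (h p) + \<psi> (h p)) = E (\<lambda>p. \<phi> (h p)) + E (\<lambda>p. \<psi> (h p))"
    and E_scale_comp: "E (\<lambda>p. a * \<phi> (h p)) = a * E (\<lambda>p. \<phi> (h p))"
proof -
  have cont: "continuous_on UNIV (\<lambda>p. \<theta> (h p))" if "continuous_on UNIV \<theta>" for \<theta> :: "real \<Rightarrow> real"
    by (rule continuous_on_compose2[OF that h]) auto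
  have mem: "Bcontfun (\<lambda>p. \<theta> (h p)) \<in> generated_subalgebra (Bcontfun h)"
    if "continuous_on UNIV \<theta>" for \<theta> :: "real \<Rightarrow> real"
    unfolding generated_subalgebra_def
    using that by (auto simp: apply_Bcontfun cont h o_def intro!: exI[of _ \<theta>] intro: continuous_on_subset)
  have lin: "linear_on (generated_subalgebra (Bcontfun h)) \<eta>"
    using qs by (simp add: quasi_state_def)
  have "Bcontfun (\<lambda>p. \<phi> (h p) + \<psi> (h p)) = Bcontfun (\<lambda>p. \<phi> (h p)) + Bcontfun (\<lambda>p. \<psi> (h p))"
    using assms by (intro bcontfun_eqI) (simp add: apply_Bcontfun cont continuous_on_add)
  then show "E (\<lambda>p. \<phi> (h p) + \<psi> (h p)) = E (\<lambda>p. \<phi> (h p)) + E (\<lambda>p. \<psi> (h p))"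
    using lin mem assms by (simp add: E_def linear_on_def)
  have "Bcontfun (\<lambda>p. a * \<phi> (h p)) = a *\<^sub>R Bcontfun (\<lambda>p. \<phi> (h p))"
    using assms by (intro bcontfun_eqI) (simp add: apply_Bcontfun cont continuous_on_mult)
  then show "E (\<lambda>p. a * \<phi> (h p)) = a * E (\<lambda>p. \<phi> (h p))"
    using lin mem assms by (simp add: E_def linear_on_def)
qed

lemma E_scale:
  assumes "continuous_on UNIV h"
  shows "E (\<lambda>p. a * h p) = a * E h"
  using E_scale_comp[OF assms, where \<phi> = "\<lambda>t. t" and \<psi> = "\<lambda>t. t"] by simp

lemma E_shift:
  assumes "continuous_on UNIV h"
  shows "E (\<lambda>p. h p + a) = E h + a"
  using E_add_comp[OF assms, of "\<lambda>t. t" "\<lambda>_. a"] E_scale[of "\<lambda>_. 1" a]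
  by (simp add: E_const)

lemma E_sum_comp:
  fixes h :: "'a \<Rightarrow> real" and \<phi> :: "'i \<Rightarrow> real \<Rightarrow> real"
  assumes "continuous_on UNIV h" "finite I" "\<And>i. i \<in> I \<Longrightarrow> continuous_on UNIV (\<phi> i)"
  shows "E (\<lambda>p. \<Sum>i\<in>I. \<phi> i (h p)) = (\<Sum>i\<in>I. E (\<lambda>p. \<phi> i (h p)))"
  using assms(2,3)
proof (induction I)
  case empty
  then show ?case using E_scale[of "\<lambda>_. 1" 0] by simp
next
  case (insert i I)
  then have "E (\<lambda>p. \<phi> i (h p) + (\<Sum>i\<in>I. \<phi> i (h p))) = E (\<lambda>p. \<phi> i (h p)) + E (\<lambda>p. \<Sum>i\<in>I. \<phi> i (h p))"
    by (intro E_add_comp[OF assms(1), of "\<phi> i" "\<lambda>t. \<Sum>i\<in>I. \<phi> i t"])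
      (auto intro!: continuous_on_sum)
  then show ?case using insert by simp
qed

section \<open>Monotonicity and the Lipschitz estimate\<close>

text \<open>The plateau makes \<open>f\<close> the part of \<open>h = f + g\<close> above level
  \<open>c\<close> and \<open>g\<close> the part below. Hence \<open>g - f\<close> is also a
  function of \<open>h\<close>, and \<open>E g\<close> exceeds \<open>E f\<close> by
  \<open>E (g - f) \<ge> 0\<close>.\<close>

lemma E_le_plateau:
  assumes f: "continuous_on UNIV f" and g: "continuous_on UNIV g"
    and bds: "\<And>p. 0 \<le> f p" "\<And>p. f p \<le> c" "\<And>p. 0 \<le> g p" "\<And>p. g p \<le> c"
    and plateau: "\<And>p. f p \<noteq> 0 \<Longrightarrow> g p = c"
  shows "E f \<le> E g"
proof -
  define h where "h p = f p + g p" for p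
  have h: "continuous_on UNIV h" unfolding h_def by (intro continuous_intros f g)
  have f_eq: "f p = max (h p - c) 0" and g_eq: "g p = min (h p) c" for p
    using bds[of p] plateau[of p] by (cases "f p = 0"; simp add: h_def)+
  let ?\<phi> = "\<lambda>t. max (t - c) 0" and ?\<psi> = "\<lambda>t. min t c - max (t - c) 0"
  have "E (\<lambda>p. ?\<phi> (h p) + ?\<psi> (h p)) = E (\<lambda>p. ?\<phi> (h p)) + E (\<lambda>p. ?\<psi> (h p))"
    by (rule E_add_comp[OF h]) (intro continuous_intros)+
  then have "E g = E f + E (\<lambda>p. g p - f p)"
    by (simp flip: f_eq g_eq)
  moreover have "f p \<le> g p" for p
    using bds[of p] plateau[of p] by (cases "f p = 0") auto
  then have "0 \<le> E (\<lambda>p. g p - f p)"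
    by (intro E_nonneg continuous_intros f g) (simp add: algebra_simps)
  ultimately show ?thesis by simp
qed

text \<open>Slices \<open>f\<close> and \<open>g\<close> into layers of height \<open>d\<close>: where the \<open>(i + 1)\<close>-st layer of \<open>f\<close> does not
  vanish, the \<open>i\<close>-th layer of \<open>g\<close> is full.\<close>

lemma E_mono_nonneg:
  assumes f: "continuous_on UNIV f" and g: "continuous_on UNIV g"
    and f0: "\<And>p. 0 \<le> f p" and fg: "\<And>p. f p \<le> g p"
  shows "E f \<le> E g"
proof (rule field_le_epsilon)
  fix d :: real assume d: "0 < d"
  obtain b where b: "\<And>p. norm (g p) \<le> b"
    using compact_imp_bounded[OF compact_continuous_image[OF g compact_space]] by (auto simp: bounded_iff)
  obtain n where n: "b < real n * d"
    using reals_Archimedean3[OF d] by blast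
  have gn: "g p \<le> real n * d" for p
    using b[of p] n by (simp add: abs_le_iff)
  have cl: "continuous_on UNIV (\<lambda>p. layer d i (h p))" if "continuous_on UNIV h" for i and h :: "'a \<Rightarrow> real"
    by (rule continuous_on_compose2[OF continuous_layer that]) auto
  have "E f = E (\<lambda>p. \<Sum>i<Suc n. layer d i (f p))"
  proof -
    have "f p = (\<Sum>i<Suc n. layer d i (f p))" for p
      using f0[of p] fg[of p] gn[of p] d by (subst sum_layer) (auto simp: algebra_simps)
    then show ?thesis by presburger
  qed
  also have "\<dots> = (\<Sum>i<Suc n. E (\<lambda>p. layer d i (f p)))"
    by (rule E_sum_comp[OF f]) (auto simp: continuous_layer)
  also have "\<dots> = E (\<lambda>p. layer d 0 (f p)) + (\<Sum>i<n. E (\<lambda>p. layer d (Suc i) (f p)))"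
    by (rule sum.lessThan_Suc_shift)
  \<comment> \<open>The bottom layer of \<open>f\<close> has no layer of \<open>g\<close> beneath
    it; it costs at most its height \<open>d\<close>, the error allowed.\<close>
  also have "E (\<lambda>p. layer d 0 (f p)) \<le> d"
  proof -
    have "0 \<le> E (\<lambda>p. (-1) * layer d 0 (f p) + d)"
      by (intro E_nonneg continuous_intros cl f) (simp add: layer_def d less_imp_le)
    also have "\<dots> = (-1) * E (\<lambda>p. layer d 0 (f p)) + d"
      by (subst E_shift, intro continuous_intros cl f, subst E_scale, intro cl f) simp
    finally show ?thesis by simp
  qed
  also have "(\<Sum>i<n. E (\<lambda>p. layer d (Suc i) (f p))) \<le> (\<Sum>i<n. E (\<lambda>p. layer d i (g p)))"
  proof (intro sum_mono E_le_plateau cl f g)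
    fix i p assume "layer d (Suc i) (f p) \<noteq> 0"
    then have "f p > real (Suc i) * d" by (auto simp: layer_def max_def split: if_splits)
    with fg[of p] have "g p > real (Suc i) * d" by linarith
    then show "layer d i (g p) = d" using d by (simp add: layer_def algebra_simps)
  qed (use d in \<open>auto simp: layer_def\<close>)
  also have "\<dots> = E (\<lambda>p. \<Sum>i<n. layer d i (g p))"
    by (rule E_sum_comp[OF g, symmetric]) (auto simp: continuous_layer)
  also have "\<dots> = E g"
  proof -
    have "g p = (\<Sum>i<n. layer d i (g p))" for p
      using f0[of p] fg[of p] gn[of p] d by (subst sum_layer) (auto simp: algebra_simps)
    then show ?thesis by presburger
  qed
  finally show "E f \<le> E g + d" by simp
qed

lemma E_mono:
  assumes f: "continuous_on UNIV f" and g: "continuous_on UNIV g" and fg: "\<And>p. f p \<le> g p"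
  shows "E f \<le> E g"
proof -
  obtain b where b: "\<And>p. norm (f p) \<le> b"
    using compact_imp_bounded[OF compact_continuous_image[OF f compact_space]] by (auto simp: bounded_iff)
  \<comment> \<open>Adding \<open>b\<close> makes both functions nonnegative; \<open>E_shift\<close>
    cancels it again.\<close>
  have "E (\<lambda>p. f p + b) \<le> E (\<lambda>p. g p + b)"
  proof (rule E_mono_nonneg)
    show "0 \<le> f p + b" for p using b[of p] by (simp add: abs_le_iff)
  qed (use f g fg in \<open>auto intro!: continuous_intros\<close>)
  then show ?thesis by (simp add: E_shift f g)
qed

lemma E_lipschitz:
  assumes f: "continuous_on UNIV f" and g: "continuous_on UNIV g" and fg: "\<And>p. \<bar>f p - g p\<bar> \<le> e"
  shows "\<bar>E f - E g\<bar> \<le> e"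
proof -
  have "f p \<le> g p + e" "g p \<le> f p + e" for p
    using fg[of p] by auto
  then have "E f \<le> E (\<lambda>p. g p + e)" "E g \<le> E (\<lambda>p. f p + e)"
    by (auto intro!: E_mono continuous_intros f g)
  then show ?thesis by (simp add: E_shift f g)
qed

text \<open>Both functions are functions of the difference \<open>f - g\<close>, namely its positive and negative
  parts.\<close>

lemma E_add_disjoint:
  assumes f: "continuous_on UNIV f" and g: "continuous_on UNIV g"
    and nonneg: "\<And>p. 0 \<le> f p" "\<And>p. 0 \<le> g p" and disj: "\<And>p. f p * g p = 0"
  shows "E (\<lambda>p. f p + g p) = E f + E g"
proof -
  define h where "h p = f p - g p" for p
  have h: "continuous_on UNIV h" unfolding h_def by (intro continuous_intros f g)
  have eqs: "max (h p) 0 = f p" "max (- h p) 0 = g p" for p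
    using nonneg[of p] disj[of p] by (auto simp: h_def)
  have "E (\<lambda>p. max (h p) 0 + max (- h p) 0) = E (\<lambda>p. max (h p) 0) + E (\<lambda>p. max (- h p) 0)"
    by (rule E_add_comp[OF h, of "\<lambda>t. max t 0" "\<lambda>t. max (-t) 0"]) (intro continuous_intros)+
  then show ?thesis by (simp add: eqs)
qed

lemma E_sum_disjoint:
  fixes f :: "'i \<Rightarrow> 'a \<Rightarrow> real"
  assumes "finite I"
    and cont: "\<And>i. i \<in> I \<Longrightarrow> continuous_on UNIV (f i)" and nonneg: "\<And>i p. i \<in> I \<Longrightarrow> 0 \<le> f i p"
    and disj: "\<And>i j p. i \<in> I \<Longrightarrow> j \<in> I \<Longrightarrow> i \<noteq> j \<Longrightarrow> f i p * f j p = 0"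
  shows "E (\<lambda>p. \<Sum>i\<in>I. f i p) = (\<Sum>i\<in>I. E (f i))"
  using assms
proof (induction I)
  case empty
  then show ?case using E_scale[of "\<lambda>_. 1" 0] by simp
next
  case (insert i I)
  have "f i p * f j p = 0" if "j \<in> I" for j p
    using insert.hyps insert.prems(3)[of i j p] that by blast
  then have "f i p * (\<Sum>j\<in>I. f j p) = 0" for p
    unfolding sum_distrib_left by (intro sum.neutral) blast
  then have "E (\<lambda>p. f i p + (\<Sum>j\<in>I. f j p)) = E (f i) + E (\<lambda>p. \<Sum>j\<in>I. f j p)"
    using insert.prems by (intro E_add_disjoint continuous_on_sum sum_nonneg) auto
  also have "E (\<lambda>p. \<Sum>j\<in>I. f j p) = (\<Sum>j\<in>I. E (f j))"
    by (rule insert.IH) (use insert.prems in auto)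
  finally show ?case using insert.hyps by simp
qed

text \<open>The step function with value \<open>c i + R - s\<close> on the support of
  \<open>f i\<close> lies below \<open>u + R\<close>, so monotonicity and additivity on disjoint
  supports give the bound. The missing mass \<open>\<epsilon>\<close> costs at most
  \<open>R * \<epsilon>\<close>.\<close>

lemma E_ge_disjoint_sum:
  fixes f :: "'i \<Rightarrow> 'a \<Rightarrow> real"
  assumes I: "finite I"
    and cont: "\<And>i. i \<in> I \<Longrightarrow> continuous_on UNIV (f i)"
    and f0: "\<And>i p. i \<in> I \<Longrightarrow> 0 \<le> f i p" and f1: "\<And>i p. i \<in> I \<Longrightarrow> f i p \<le> 1"
    and disj: "\<And>i j p. i \<in> I \<Longrightarrow> j \<in> I \<Longrightarrow> i \<noteq> j \<Longrightarrow> f i p * f j p = 0"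
    and total: "1 - \<epsilon> \<le> (\<Sum>i\<in>I. E (f i))"
    and u: "continuous_on UNIV u" and uR: "\<And>p. \<bar>u p\<bar> \<le> R" and s: "0 \<le> s"
    and near: "\<And>i p. i \<in> I \<Longrightarrow> f i p \<noteq> 0 \<Longrightarrow> \<bar>u p - c i\<bar> \<le> s"
  shows "(\<Sum>i\<in>I. c i * E (f i)) - s - R * \<epsilon> \<le> E u"
proof -
  let ?T = "\<Sum>i\<in>I. E (f i)"
  \<comment> \<open>Additivity on disjoint supports asks for nonnegative summands, hence the
    truncation at 0; it preserves the comparison since \<open>u + R \<ge> 0\<close>.\<close>
  define m where "m i = max 0 (c i + R - s)" for i
  have R: "0 \<le> R" using uR[of undefined] by linarith
  have "?T = E (\<lambda>p. \<Sum>i\<in>I. f i p)"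
    by (rule E_sum_disjoint[symmetric]) (use assms in auto)
  also have "\<dots> \<le> E (\<lambda>_. 1)"
  proof (intro E_mono continuous_on_sum cont)
    show "(\<Sum>i\<in>I. f i p) \<le> 1" for p
      using disjoint_sum_le[OF I, of 1 "\<lambda>i. f i p" "\<lambda>_. 1"] disj f1 by simp
  qed auto
  finally have T1: "?T \<le> 1" by (simp add: E_const)
  have "(\<Sum>i\<in>I. (c i + R - s) * E (f i)) \<le> (\<Sum>i\<in>I. m i * E (f i))"
    by (intro sum_mono mult_right_mono E_nonneg cont f0) (auto simp: m_def)
  also have "\<dots> = (\<Sum>i\<in>I. E (\<lambda>p. m i * f i p))"
    by (intro sum.cong refl E_scale[symmetric] cont)
  also have "\<dots> = E (\<lambda>p. \<Sum>i\<in>I. m i * f i p)"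
    using disj by (intro E_sum_disjoint[symmetric] I continuous_intros cont mult_nonneg_nonneg f0)
      (auto simp: m_def)
  also have "\<dots> \<le> E (\<lambda>p. u p + R)"
  proof (intro E_mono continuous_intros cont u)
    fix p
    show "(\<Sum>i\<in>I. m i * f i p) \<le> u p + R"
    proof (rule disjoint_sum_le[OF I])
      show "0 \<le> u p + R" using uR[of p] by linarith
      fix i assume i: "i \<in> I" "f i p \<noteq> 0"
      have "m i * f i p \<le> m i" using f1[OF i(1)] by (intro mult_left_le) (auto simp: m_def)
      also have "m i \<le> u p + R" using near[OF i] uR[of p] by (auto simp: m_def)
      finally show "m i * f i p \<le> u p + R" .
    qed (use disj in auto)
  qed
  also have "\<dots> = E u + R" by (rule E_shift[OF u])
  finally have "(\<Sum>i\<in>I. c i * E (f i)) + (R - s) * ?T \<le> E u + R"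
    by (simp add: algebra_simps sum.distrib sum_subtractf sum_distrib_left)
  moreover have "R * ?T \<ge> R * (1 - \<epsilon>)" using total R by (rule mult_left_mono)
  moreover have "s * ?T \<le> s" using T1 s by (rule mult_left_le)
  ultimately show ?thesis by (simp add: algebra_simps)
qed

text \<open>The upper estimate is the lower one for \<open>-u\<close> with values
  \<open>- c i\<close>.\<close>

lemma E_approx_disjoint_sum:
  fixes f :: "'i \<Rightarrow> 'a \<Rightarrow> real"
  assumes I: "finite I"
    and cont: "\<And>i. i \<in> I \<Longrightarrow> continuous_on UNIV (f i)"
    and f0: "\<And>i p. i \<in> I \<Longrightarrow> 0 \<le> f i p" and f1: "\<And>i p. i \<in> I \<Longrightarrow> f i p \<le> 1"
    and disj: "\<And>i j p. i \<in> I \<Longrightarrow> j \<in> I \<Longrightarrow> i \<noteq> j \<Longrightarrow> f i p * f j p = 0"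
    and total: "1 - \<epsilon> \<le> (\<Sum>i\<in>I. E (f i))"
    and u: "continuous_on UNIV u" and uR: "\<And>p. \<bar>u p\<bar> \<le> R" and s: "0 \<le> s"
    and near: "\<And>i p. i \<in> I \<Longrightarrow> f i p \<noteq> 0 \<Longrightarrow> \<bar>u p - c i\<bar> \<le> s"
  shows "\<bar>E u - (\<Sum>i\<in>I. c i * E (f i))\<bar> \<le> s + R * \<epsilon>"
proof -
  have "(\<Sum>i\<in>I. c i * E (f i)) - s - R * \<epsilon> \<le> E u"
    by (rule E_ge_disjoint_sum) (use assms in auto)
  moreover have "(\<Sum>i\<in>I. (- c i) * E (f i)) - s - R * \<epsilon> \<le> E (\<lambda>p. (-1) * u p)"
  proof (rule E_ge_disjoint_sum)
    show "\<bar>(-1) * u p - (- c i)\<bar> \<le> s" if "i \<in> I" "f i p \<noteq> 0" for i p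
      using near[OF that] by linarith
  qed (use assms in \<open>auto intro!: continuous_intros\<close>)
  ultimately show ?thesis by (simp add: E_scale[OF u, of "-1", simplified] sum_negf abs_le_iff)
qed

text \<open>Cutting \<open>h\<close> at \<open>n\<close> different levels loses \<open>n\<close> bumps with disjoint supports, so one of them
  has \<open>E\<close>-value at most \<open>1 / n\<close>.\<close>

lemma E_cut_small_loss:
  fixes h :: "'a \<Rightarrow> real"
  assumes h: "continuous_on UNIV h" and "0 < \<epsilon>"
  obtains f g :: "'a \<Rightarrow> real" where
    "continuous_on UNIV f" "continuous_on UNIV g"
    "\<And>p. 0 \<le> f p" "\<And>p. f p \<le> 1" "\<And>p. 0 \<le> g p" "\<And>p. g p \<le> 1" "\<And>p. f p * g p = 0"
    "\<And>p. f p \<noteq> 0 \<Longrightarrow> 0 < h p" "\<And>p. g p \<noteq> 0 \<Longrightarrow> h p < 1"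
    "1 - \<epsilon> \<le> E (\<lambda>p. f p + g p)"
proof -
  obtain n where n: "0 < n" "inverse (real n) < \<epsilon>"
    using ex_inverse_of_nat_less[OF \<open>0 < \<epsilon>\<close>] by blast
  \<comment> \<open>\<open>up k\<close> and \<open>dn k\<close> live on the two sides of the
    midpoint of \<open>[k/n, (k+1)/n]\<close> and equal 1 beyond the respective end of that
    interval. What they miss, \<open>bump k\<close>, is supported inside it.\<close>
  define up where "up k t = ramp (2 * (real n * t - real k) - 1)" for k t
  define dn where "dn k t = ramp (1 - 2 * (real n * t - real k))" for k t
  define bump where "bump k t = 1 - (up k t + dn k t)" for k t
  have cont: "continuous_on UNIV (up k)" "continuous_on UNIV (dn k)" "continuous_on UNIV (bump k)" for k
    unfolding up_def dn_def bump_def by (intro continuous_intros)+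
  have cont_h: "continuous_on UNIV (\<lambda>p. \<theta> (h p))" if "continuous_on UNIV \<theta>" for \<theta> :: "real \<Rightarrow> real"
    by (rule continuous_on_compose2[OF that h]) auto
  have bump01: "0 \<le> bump k t" "bump k t \<le> 1" for k t
    by (auto simp: bump_def up_def dn_def ramp_def)
  have bump_supp: "real k < real n * t" "real n * t < real k + 1" if "bump k t \<noteq> 0" for k t
    using that by (auto simp: bump_def up_def dn_def ramp_def max_def min_def split: if_splits)
  have bump_disj: "bump j t * bump k t = 0" if "j \<noteq> k" for j k t
  proof (rule ccontr)
    assume "bump j t * bump k t \<noteq> 0"
    then have "bump j t \<noteq> 0" "bump k t \<noteq> 0" by auto
    from this[THEN bump_supp(1)] this[THEN bump_supp(2)] have "real j < real k + 1" "real k < real j + 1"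
      by linarith+
    then show False using that by linarith
  qed
  have "\<exists>k<n. E (\<lambda>p. bump k (h p)) \<le> 1 / real n"
  proof (rule ccontr)
    assume "\<not> ?thesis"
    then have "(\<Sum>k<n. 1 / real n) < (\<Sum>k<n. E (\<lambda>p. bump k (h p)))"
      using n by (intro sum_strict_mono) auto
    then have "1 < (\<Sum>k<n. E (\<lambda>p. bump k (h p)))" using n by simp
    also have "\<dots> = E (\<lambda>p. \<Sum>k<n. bump k (h p))"
      by (rule E_sum_comp[OF h, symmetric]) (auto simp: cont)
    also have "\<dots> \<le> E (\<lambda>_. 1)"
    proof (intro E_mono continuous_on_sum cont_h cont)
      show "(\<Sum>k<n. bump k (h p)) \<le> 1" for p
        using disjoint_sum_le[of "{..<n}" 1 "\<lambda>k. bump k (h p)" "\<lambda>_. 1"] bump_disj bump01 by simp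
    qed auto
    finally show False by (simp add: E_const)
  qed
  then obtain k where k: "k < n" "E (\<lambda>p. bump k (h p)) \<le> 1 / real n" by blast
  show thesis
  proof (rule that[of "\<lambda>p. up k (h p)" "\<lambda>p. dn k (h p)"])
    have "E (\<lambda>p. up k (h p) + dn k (h p)) = E (\<lambda>p. (-1) * bump k (h p) + 1)"
      by (simp add: bump_def)
    also have "\<dots> = - E (\<lambda>p. bump k (h p)) + 1"
      by (subst E_shift, intro continuous_intros cont_h cont, subst E_scale, intro cont_h cont) simp
    finally show "1 - \<epsilon> \<le> E (\<lambda>p. up k (h p) + dn k (h p))"
      using k(2) n(2) by (simp add: inverse_eq_divide)
    fix p
    show "up k (h p) * dn k (h p) = 0"
      by (auto simp: up_def dn_def ramp_def max_def min_def)
    show "0 < h p" if "up k (h p) \<noteq> 0"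
    proof -
      have "0 < real n * h p" using that by (auto simp: up_def ramp_def max_def split: if_splits)
      then show ?thesis using n by (simp add: zero_less_mult_iff)
    qed
    show "h p < 1" if "dn k (h p) \<noteq> 0"
    proof -
      have "real n * h p < real k + 1" using that by (auto simp: dn_def ramp_def max_def split: if_splits)
      also have "\<dots> \<le> real n * 1" using k by linarith
      finally show ?thesis using n by (simp only: mult_less_cancel_left_pos of_nat_0_less_iff)
    qed
    show "0 \<le> up k (h p)" "up k (h p) \<le> 1" "0 \<le> dn k (h p)" "dn k (h p) \<le> 1"
      by (auto simp: up_def dn_def ramp_def)
  qed (intro cont_h cont)+
qed

end


section \<open>Maps to the plane avoiding the integer lattice\<close>

text \<open>The complement of the lattice is covered by the open unit squares with vertices in the
  lattice, and the open \<open>\<ell>\<^sup>1\<close>-balls of radius \<open>1 / 2\<close> around the midpoints of their edges. The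
  square or ball with index \<open>(b, i, j)\<close> has centre \<open>(i / 2, j / 2)\<close>.\<close>

definition piece_index :: "bool \<times> int \<times> int \<Rightarrow> bool" where
  "piece_index = (\<lambda>(b, i, j). if b then odd i \<and> odd j else odd (i + j))"

definition piece :: "bool \<times> int \<times> int \<Rightarrow> (real \<times> real) set" where
  "piece = (\<lambda>(b, i, j). {(x, y).
     if b then \<bar>x - real_of_int i / 2\<bar> < 1 / 2 \<and> \<bar>y - real_of_int j / 2\<bar> < 1 / 2
     else \<bar>x - real_of_int i / 2\<bar> + \<bar>y - real_of_int j / 2\<bar> < 1 / 2})"

lemma open_piece: "open (piece k)"
proof -
  obtain b i j where k: "k = (b, i, j)" by (cases k)
  show ?thesis
    unfolding piece_def k case_prod_beta
    by (cases b; simp only: if_True if_False prod.sel)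
      (intro open_Collect_conj open_Collect_less continuous_intros)+
qed

lemma piece_near:
  assumes "(x, y) \<in> piece (b, i, j)"
  shows "\<bar>x - real_of_int i / 2\<bar> \<le> 1 / 2" "\<bar>y - real_of_int j / 2\<bar> \<le> 1 / 2"
  using assms abs_ge_zero[of "x - real_of_int i / 2"] abs_ge_zero[of "y - real_of_int j / 2"]
  unfolding piece_def by (auto simp del: abs_ge_zero split: if_splits)

text \<open>Parity separates pieces of one kind: the half-integer indices of distinct centres differ
  by at least 2, in the larger coordinate for squares and in the sum of both for balls.\<close>

lemma piece_disjoint:
  assumes "piece_index (b, k)" "piece_index (b, l)" "k \<noteq> l"
  shows "piece (b, k) \<inter> piece (b, l) = {}"
proof -
  obtain i j i' j' where kl: "k = (i, j)" "l = (i', j')" by (cases k, cases l)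
  have False if xy: "(x, y) \<in> piece (b, i, j)" "(x, y) \<in> piece (b, i', j')" for x y
  proof (cases b)
    case True
    then have "\<bar>x - i / 2\<bar> < 1 / 2" "\<bar>y - j / 2\<bar> < 1 / 2" "\<bar>x - i' / 2\<bar> < 1 / 2" "\<bar>y - j' / 2\<bar> < 1 / 2"
      using xy by (auto simp: piece_def)
    then have "\<bar>real_of_int i - real_of_int i'\<bar> < 2" "\<bar>real_of_int j - real_of_int j'\<bar> < 2"
      by argo+
    then have "\<bar>i - i'\<bar> < 2" "\<bar>j - j'\<bar> < 2" by linarith+
    moreover have "even (i - i')" "even (j - j')"
      using assms True by (auto simp: piece_index_def kl)
    ultimately have "i = i'" "j = j'" by presburger+
    then show False using assms kl by simp
  next
    case False
    then have "\<bar>x - i / 2\<bar> + \<bar>y - j / 2\<bar> < 1 / 2" "\<bar>x - i' / 2\<bar> + \<bar>y - j' / 2\<bar> < 1 / 2"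
      using xy by (auto simp: piece_def)
    then have "\<bar>real_of_int i - real_of_int i'\<bar> + \<bar>real_of_int j - real_of_int j'\<bar> < 2"
      by argo
    then have "\<bar>i - i'\<bar> + \<bar>j - j'\<bar> < 2" by linarith
    moreover have "odd (i + j)" "odd (i' + j')"
      using assms False by (auto simp: piece_index_def kl)
    ultimately have "i = i' \<and> j = j'" by presburger
    then show False using assms kl by simp
  qed
  then show ?thesis unfolding kl by auto
qed

section \<open>Distance to the integers and the two families of pieces\<close>

lemma infdist_Ints_eq:
  obtains i where "infdist x (\<int> :: real set) = \<bar>x - real_of_int i\<bar>"
proof -
  obtain z where "z \<in> (\<int> :: real set)" "infdist x \<int> = dist x z"
    using infdist_attains_inf[of "\<int> :: real set" x] Ints_0 by (metis closed_Ints empty_iff)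
  then show thesis using that by (auto elim!: Ints_cases simp: dist_real_def)
qed

text \<open>Between consecutive integers, the distances to the nearer end and to the midpoint add up
  to 1/2.\<close>

lemma infdist_Ints_floor:
  "infdist x (\<int> :: real set) \<le> 1 / 2 - \<bar>x - real_of_int (2 * \<lfloor>x\<rfloor> + 1) / 2\<bar>"
proof -
  have "infdist x (\<int> :: real set) \<le> dist x (of_int \<lfloor>x\<rfloor>)" "infdist x (\<int> :: real set) \<le> dist x (of_int (\<lfloor>x\<rfloor> + 1))"
    by (intro infdist_le; simp)+
  moreover have "real_of_int \<lfloor>x\<rfloor> \<le> x" "x < real_of_int \<lfloor>x\<rfloor> + 1"
    by linarith+
  ultimately show ?thesis
    by (simp add: dist_real_def abs_if add_divide_distrib split: if_splits)
qed

lemma squares_cover: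
  assumes "0 < infdist x (\<int> :: real set)" "0 < infdist y (\<int> :: real set)"
  shows "\<exists>k. piece_index (True, k) \<and> (x, y) \<in> piece (True, k)"
  using assms infdist_Ints_floor[of x] infdist_Ints_floor[of y]
  by (intro exI[of _ "(2 * \<lfloor>x\<rfloor> + 1, 2 * \<lfloor>y\<rfloor> + 1)"]) (simp add: piece_index_def piece_def)

text \<open>Round the coordinate nearer to the integers to its nearest integer and move the other to
  the middle of its unit interval. This gives an edge midpoint at distance less than 1/2 in the sum
  norm.\<close>

lemma diamonds_cover:
  assumes "infdist x (\<int> :: real set) \<noteq> infdist y (\<int> :: real set)"
  shows "\<exists>k. piece_index (False, k) \<and> (x, y) \<in> piece (False, k)"
proof -
  obtain i j where ij: "infdist x (\<int> :: real set) = \<bar>x - real_of_int i\<bar>"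
      "infdist y (\<int> :: real set) = \<bar>y - real_of_int j\<bar>"
    using infdist_Ints_eq by metis
  show ?thesis
  proof (cases "infdist x (\<int> :: real set) < infdist y (\<int> :: real set)")
    case True
    then show ?thesis
      using infdist_Ints_floor[of y] ij
      by (intro exI[of _ "(2 * i, 2 * \<lfloor>y\<rfloor> + 1)"]) (simp add: piece_index_def piece_def)
  next
    case False
    then show ?thesis
      using assms infdist_Ints_floor[of x] ij
      by (intro exI[of _ "(2 * \<lfloor>x\<rfloor> + 1, 2 * j)"]) (simp add: piece_index_def piece_def)
  qed
qed

section \<open>Additivity up to a bounded error off a lattice\<close>

context compact_quasi_state
begin

text \<open>Cutting \<open>h\<close> yields \<open>f\<close> carried by the squares and
  \<open>g\<close> carried by the balls, with disjoint supports and almost full mass. Splitting them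
  over the pieces gives a disjoint family on whose supports \<open>x\<close> and \<open>y\<close>
  are within 1/2 of constants, so \<open>E x\<close>, \<open>E y\<close> and
  \<open>E (x + y)\<close> are approximated with common weights.\<close>

lemma E_add_avoiding_lattice:
  assumes x: "continuous_on UNIV x" and y: "continuous_on UNIV y"
    and avoid: "\<And>p. \<not> (x p \<in> \<int> \<and> y p \<in> \<int>)"
  shows "\<bar>E (\<lambda>p. x p + y p) - E x - E y\<bar> \<le> 2"
proof (rule field_le_epsilon)
  fix e :: real assume e: "0 < e"
  obtain bx where bx: "\<And>p. norm (x p) \<le> bx"
    using compact_imp_bounded[OF compact_continuous_image[OF x compact_space]] by (auto simp: bounded_iff)
  obtain bY where bY: "\<And>p. norm (y p) \<le> bY"
    using compact_imp_bounded[OF compact_continuous_image[OF y compact_space]] by (auto simp: bounded_iff)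
  define R where "R = bx + bY + 1"
  have "0 \<le> bx" "0 \<le> bY" using bx[of undefined] bY[of undefined] by auto
  then have R: "0 < R" "\<bar>x p\<bar> \<le> R" "\<bar>y p\<bar> \<le> R" "\<bar>x p + y p\<bar> \<le> R" for p
    using bx[of p] bY[of p] by (auto simp: R_def)
  \<comment> \<open>Each of the three approximations below loses \<open>R * \<epsilon>\<close>,
    together \<open>e\<close>.\<close>
  define \<epsilon> where "\<epsilon> = e / (3 * R)"
  have \<epsilon>: "0 < \<epsilon>" using e R by (simp add: \<epsilon>_def)

  define a where "a p = infdist (x p) (\<int> :: real set)" for p
  define b where "b p = infdist (y p) (\<int> :: real set)" for p
  have ab0: "0 \<le> a p" "0 \<le> b p" for p by (auto simp: a_def b_def infdist_nonneg)
  have "(z \<in> \<int>) = (infdist z \<int> = 0)" for z :: real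
    using Ints_0 by (intro in_closed_iff_infdist_zero) auto
  then have "a p \<noteq> 0 \<or> b p \<noteq> 0" for p
    using avoid[of p] by (auto simp: a_def b_def)
  then have ab: "0 < max (a p) (b p)" for p
    using ab0[of p] unfolding less_max_iff_disj by (metis less_le)
  have cab: "continuous_on UNIV a" "continuous_on UNIV b"
    unfolding a_def b_def by (intro continuous_on_infdist x y)+
  \<comment> \<open>positive inside the squares, less than \<open>1\<close> inside the \<open>\<ell>\<^sup>1\<close>-balls\<close>
  define h where "h p = min (a p) (b p) / max (a p) (b p)" for p
  have h: "continuous_on UNIV h"
    unfolding h_def using ab by (intro continuous_intros cab) (simp add: less_le)
  obtain f g where fg: "continuous_on UNIV f" "continuous_on UNIV g"
    "\<And>p. 0 \<le> f p" "\<And>p. f p \<le> 1" "\<And>p. 0 \<le> g p" "\<And>p. g p \<le> 1" "\<And>p. f p * g p = 0"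
    and supp: "\<And>p. f p \<noteq> 0 \<Longrightarrow> 0 < h p" "\<And>p. g p \<noteq> 0 \<Longrightarrow> h p < 1"
    and loss: "1 - \<epsilon> \<le> E (\<lambda>p. f p + g p)"
    using E_cut_small_loss[OF h \<epsilon>] by blast

  \<comment> \<open>A piece that is hit has its centre within 1/2 of values bounded by
    \<open>R\<close>, so its doubled coordinates are at most \<open>2 * R + 1\<close>: finitely many
    pieces suffice.\<close>
  define N where "N = \<lceil>2 * R + 1\<rceil>"
  define I where "I = {k. piece_index k} \<inter> UNIV \<times> {-N..N} \<times> {-N..N}"
  have "finite I" unfolding I_def by auto
  have in_I: "(c, i, j) \<in> I" if "piece_index (c, i, j)" "(x p, y p) \<in> piece (c, i, j)" for c i j p
  proof -
    have "\<bar>real_of_int i\<bar> \<le> 2 * R + 1" "\<bar>real_of_int j\<bar> \<le> 2 * R + 1"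
      using piece_near[OF that(2)] R(2,3)[of p] by linarith+
    then show ?thesis using that(1) unfolding I_def N_def by (simp add: abs_le_iff) linarith
  qed
  define w where "w c = (if c then f else g)" for c :: bool
  define F where "F k p = (if (x p, y p) \<in> piece k then w (fst k) p else 0)" for k p
  have w01: "0 \<le> w c p" "w c p \<le> 1" for c p using fg by (auto simp: w_def)
  have covered: "\<exists>k. (c, k) \<in> I \<and> (x p, y p) \<in> piece (c, k)" if "w c p \<noteq> 0" for c p
  proof -
    have "\<exists>k. piece_index (c, k) \<and> (x p, y p) \<in> piece (c, k)"
    proof (cases c)
      case True
      then have "0 < h p" using that supp by (simp add: w_def)
      then have "0 < min (a p) (b p)"
        using ab[of p] by (simp only: h_def zero_less_divide_iff) linarith
      then show ?thesis using True squares_cover[of "x p" "y p"] by (simp add: a_def b_def)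
    next
      case False
      then have "h p < 1" using that supp by (simp add: w_def)
      then have "a p \<noteq> b p" using ab[of p] by (auto simp: h_def)
      then show ?thesis using False diamonds_cover[of "x p" "y p"] by (simp add: a_def b_def)
    qed
    then show ?thesis using in_I by fast
  qed
  have contF: "continuous_on UNIV (F k)" if "k \<in> I" for k
  proof -
    obtain c l where k: "k = (c, l)" by (cases k)
    have "continuous_on UNIV (\<lambda>p. if p \<in> (\<lambda>p. (x p, y p)) -` piece (c, l) then w c p else 0)"
    proof (rule continuous_on_restrict_piece[where J = "{l. (c, l) \<in> I}"])
      show "continuous_on UNIV (w c)" using fg by (simp add: w_def)
      show "open ((\<lambda>p. (x p, y p)) -` piece (c, j))" for j
        by (intro open_vimage open_piece continuous_intros x y)
      show "(\<lambda>p. (x p, y p)) -` piece (c, j) \<inter> (\<lambda>p. (x p, y p)) -` piece (c, k) = {}"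
        if "j \<in> {l. (c, l) \<in> I}" "k \<in> {l. (c, l) \<in> I}" "j \<noteq> k" for j k
        using piece_disjoint[of c j k] that by (auto simp: I_def)
      show "\<exists>j\<in>{l. (c, l) \<in> I}. p \<in> (\<lambda>p. (x p, y p)) -` piece (c, j)" if "w c p \<noteq> 0" for p
        using covered[OF that] by auto
    qed (use that k in simp)
    then show ?thesis unfolding F_def[abs_def] k by (simp only: vimage_eq fst_conv)
  qed
  have F01: "0 \<le> F k p" "F k p \<le> 1" for k p using w01 by (auto simp: F_def)
  have disjF: "F k p * F l p = 0" if "k \<in> I" "l \<in> I" "k \<noteq> l" for k l p
  proof (cases "fst k = fst l")
    case True
    then have "piece k \<inter> piece l = {}"
      using that piece_disjoint[of "fst k" "snd k" "snd l"] by (auto simp: I_def prod_eq_iff)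
    then show ?thesis by (auto simp: F_def)
  next
    case False
    then show ?thesis using fg(7)[of p] by (auto simp: F_def w_def)
  qed
  have total: "1 - \<epsilon> \<le> (\<Sum>k\<in>I. E (F k))"
  proof -
    note loss
    also have "E (\<lambda>p. f p + g p) \<le> E (\<lambda>p. \<Sum>k\<in>I. F k p)"
    proof (intro E_mono continuous_intros contF fg(1,2))
      \<comment> \<open>At most one of \<open>f p\<close> and \<open>g p\<close> is nonzero, and
        that value reappears as \<open>F\<close> of the piece containing the image point.\<close>
      fix p
      show "f p + g p \<le> (\<Sum>k\<in>I. F k p)"
      proof (cases "f p + g p = 0")
        case True
        then show ?thesis by (simp add: F01 sum_nonneg)
      next
        case False
        then obtain c where c: "w c p \<noteq> 0" "f p + g p = w c p"
          using fg(7)[of p] by (cases "f p = 0") (auto simp: w_def)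
        obtain k where k: "(c, k) \<in> I" "(x p, y p) \<in> piece (c, k)" using covered[OF c(1)] by blast
        have "F (c, k) p \<le> (\<Sum>k\<in>I. F k p)"
          by (rule member_le_sum[OF k(1)]) (auto simp: F01 \<open>finite I\<close>)
        then show ?thesis using k c by (simp add: F_def)
      qed
    qed
    also have "\<dots> = (\<Sum>k\<in>I. E (F k))"
      by (rule E_sum_disjoint) (use \<open>finite I\<close> contF F01 disjF in auto)
    finally show ?thesis .
  qed
  define cx :: "bool \<times> int \<times> int \<Rightarrow> real" where "cx = (\<lambda>(b, i, j). of_int i / 2)"
  define cy :: "bool \<times> int \<times> int \<Rightarrow> real" where "cy = (\<lambda>(b, i, j). of_int j / 2)"
  have near: "\<bar>x p - cx k\<bar> \<le> 1 / 2" "\<bar>y p - cy k\<bar> \<le> 1 / 2" if "F k p \<noteq> 0" for k p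
  proof -
    have "(x p, y p) \<in> piece (fst k, fst (snd k), snd (snd k))"
      using that by (auto simp: F_def split: if_splits)
    from piece_near[OF this] show "\<bar>x p - cx k\<bar> \<le> 1 / 2" "\<bar>y p - cy k\<bar> \<le> 1 / 2"
      by (auto simp: cx_def cy_def case_prod_beta)
  qed
  note approx = E_approx_disjoint_sum[OF \<open>finite I\<close> contF F01 disjF total]
  have "\<bar>E x - (\<Sum>k\<in>I. cx k * E (F k))\<bar> \<le> 1 / 2 + R * \<epsilon>"
    by (rule approx) (use x R near in auto)
  moreover have "\<bar>E y - (\<Sum>k\<in>I. cy k * E (F k))\<bar> \<le> 1 / 2 + R * \<epsilon>"
    by (rule approx) (use y R near in auto)
  moreover have "\<bar>E (\<lambda>p. x p + y p) - (\<Sum>k\<in>I. (cx k + cy k) * E (F k))\<bar> \<le> 1 + R * \<epsilon>"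
  proof (rule approx)
    show "\<bar>x p + y p - (cx k + cy k)\<bar> \<le> 1" if "F k p \<noteq> 0" for k p
      using near[OF that] by linarith
  qed (use x y R in \<open>auto intro!: continuous_intros\<close>)
  moreover have "R * \<epsilon> = e / 3" using R by (simp add: \<epsilon>_def)
  \<comment> \<open>The weighted sums for \<open>x\<close> and \<open>y\<close> add up exactly to
    the third one; the errors 1/2, 1/2 and 1 remain, besides \<open>e\<close>.\<close>
  ultimately show "\<bar>E (\<lambda>p. x p + y p) - E x - E y\<bar> \<le> 2 + e"
    by (simp add: algebra_simps sum.distrib)
qed

text \<open>An affine change of coordinates reduces to the unit lattice: the offsets cancel in the
  additivity defect, and the scale \<open>s\<close> factors out.\<close>

lemma E_add_avoiding_scaled_lattice:
  assumes F: "continuous_on UNIV F" and G: "continuous_on UNIV G" and s: "0 < s"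
    and avoid: "\<And>p. \<not> ((F p - \<alpha>) / s \<in> \<int> \<and> (G p - \<beta>) / s \<in> \<int>)"
  shows "\<bar>E (\<lambda>p. F p + G p) - E F - E G\<bar> \<le> 2 * s"
proof -
  define x where "x p = (F p - \<alpha>) / s" for p
  define y where "y p = (G p - \<beta>) / s" for p
  have x: "continuous_on UNIV x" and y: "continuous_on UNIV y"
    unfolding x_def y_def using s by (intro continuous_intros F G; simp)+
  have cs: "continuous_on UNIV (\<lambda>p. s * z p)" if "continuous_on UNIV z" for z :: "'a \<Rightarrow> real"
    by (intro continuous_intros that)
  have xy: "continuous_on UNIV (\<lambda>p. x p + y p)" by (intro continuous_intros x y)
  have "E F = E (\<lambda>p. s * x p + \<alpha>)" "E G = E (\<lambda>p. s * y p + \<beta>)"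
    "E (\<lambda>p. F p + G p) = E (\<lambda>p. s * (x p + y p) + (\<alpha> + \<beta>))"
    using s by (simp_all add: x_def y_def distrib_left)
  then have "E (\<lambda>p. F p + G p) - E F - E G = s * (E (\<lambda>p. x p + y p) - E x - E y)"
    by (simp add: E_shift[OF cs] E_scale x y xy right_diff_distrib del: distrib_left)
  moreover have "\<bar>E (\<lambda>p. x p + y p) - E x - E y\<bar> \<le> 2"
    using avoid by (intro E_add_avoiding_lattice x y) (simp add: x_def y_def)
  ultimately show ?thesis using s by (simp add: abs_mult)
qed

end

section \<open>The area of the image\<close>

text \<open>Written with basis vectors so that the derivative rules for sums and scalings apply
  directly.\<close>

definition plane_map :: "('a \<Rightarrow> real) \<Rightarrow> ('a \<Rightarrow> real) \<Rightarrow> 'a \<Rightarrow> real^2" where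
  "plane_map F G p = F p *\<^sub>R axis 1 1 + G p *\<^sub>R axis 2 1"

lemma plane_map_nth [simp]: "plane_map F G p $ 1 = F p" "plane_map F G p $ 2 = G p"
  by (simp_all add: plane_map_def axis_def)

text \<open>\<open>C\<close> is uniform in \<open>F\<close>, \<open>G\<close> and
  \<open>\<delta>\<close>. The enclosing set \<open>K\<close> leaves room to replace an open
  \<open>U\<close> by a compact ball and to unite local estimates.\<close>

definition bracket_bounds_area :: "'a::topological_space chart set \<Rightarrow> 'a form2 \<Rightarrow> 'a set \<Rightarrow> real \<Rightarrow> bool" where
  "bracket_bounds_area A \<omega> U C \<longleftrightarrow> (\<forall>F G \<delta>. smooth_fun A F \<longrightarrow> smooth_fun A G \<longrightarrow>
     (\<forall>q. \<bar>poisson_bracket A \<omega> F G q\<bar> \<le> \<delta>) \<longrightarrow>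
     (\<exists>K\<in>lmeasurable. plane_map F G ` U \<subseteq> K \<and> measure lebesgue K \<le> C * \<delta>))"

text \<open>The bracket times the coefficient of \<open>\<omega>\<close> is the Jacobian of \<open>(F, G)\<close> in a chart.\<close>

lemma local_image_area_le_bracket:
  fixes A :: "'a::t2_space chart set"
  assumes A: "smooth_atlas A" and \<omega>: "area_form A \<omega>"
  obtains U C where "open U" "p \<in> U" "0 \<le> C" "bracket_bounds_area A \<omega> U C"
proof -
  obtain c where c: "c \<in> A" "p \<in> dom_chart c" using A unfolding smooth_atlas_def by blast
  let ?S = "coord c ` dom_chart c" and ?inv = "inv_coord c"
  have ch: "is_chart c" using A c by (auto simp: smooth_atlas_def)
  then have S: "open ?S" and dom: "open (dom_chart c)"
    and hom: "homeomorphism (dom_chart c) ?S (coord c) ?inv"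
    by (auto simp: is_chart_def)
  have inv_dom: "?inv x \<in> dom_chart c" and coord_inv: "coord c (?inv x) = x" if "x \<in> ?S" for x
    using hom that by (auto simp: homeomorphism_def)
  \<comment> \<open>On a closed ball the density of \<open>\<omega>\<close> is bounded by
    compactness; \<open>U\<close> is the open ball pulled back.\<close>
  obtain r where r: "0 < r" "cball (coord c p) r \<subseteq> ?S"
    using S c(2) open_contains_cball by blast
  let ?B = "cball (coord c p) r"
  let ?w = "\<lambda>x. \<omega> c (?inv x) (axis 1 1) (axis 2 1)"
  have "smooth_on ?S ?w" using \<omega> c by (auto simp: area_form_def two_form_def)
  then have "continuous_on ?S ?w" by (metis smooth_on_def C_k_on.simps(1))
  then have "continuous_on ?B ?w" using r(2) by (rule continuous_on_subset)
  then have "bounded (?w ` ?B)" by (intro compact_imp_bounded compact_continuous_image) auto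
  then obtain W where "\<forall>y\<in>?w ` ?B. norm y \<le> W" unfolding bounded_iff by blast
  then have W: "\<bar>?w x\<bar> \<le> W" if "x \<in> ?B" for x using that by simp
  have "0 \<le> W" using W[of "coord c p"] r by force
  define U where "U = dom_chart c \<inter> coord c -` ball (coord c p) r"
  have bound: "\<exists>K\<in>lmeasurable. plane_map F G ` U \<subseteq> K \<and> measure lebesgue K \<le> W * measure lebesgue ?B * \<delta>"
    if F: "smooth_fun A F" and G: "smooth_fun A G" and \<delta>: "\<forall>q. \<bar>poisson_bracket A \<omega> F G q\<bar> \<le> \<delta>" for F G \<delta>
  proof -
    let ?f = "plane_map (F \<circ> ?inv) (G \<circ> ?inv)"
    let ?D = "\<lambda>H x. frechet_derivative (H \<circ> ?inv) (at x)"
    let ?f' = "\<lambda>x. plane_map (?D F x) (?D G x)"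
    have D: "((H \<circ> ?inv) has_derivative ?D H x) (at x within ?B)" "continuous_on ?B (\<lambda>x. ?D H x v)"
      if H: "smooth_fun A H" and x: "x \<in> ?B" for H x v
    proof -
      have sm: "smooth_on ?S (H \<circ> ?inv)" using H c by (simp add: smooth_fun_def)
      then have "(H \<circ> ?inv) differentiable (at x)"
        using x r by (intro smooth_on_differentiable[of ?S]) auto
      then show "((H \<circ> ?inv) has_derivative ?D H x) (at x within ?B)"
        using frechet_derivative_works has_derivative_at_withinI by blast
      have "C_k_on (Suc 0) ?S (H \<circ> ?inv)" using sm unfolding smooth_on_def by (rule spec)
      then have "continuous_on ?S (\<lambda>x. ?D H x v)" by simp
      then show "continuous_on ?B (\<lambda>x. ?D H x v)" using r(2) by (rule continuous_on_subset)
    qed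
    have deriv: "(?f has_derivative ?f' x) (at x within ?B)" if "x \<in> ?B" for x
      unfolding plane_map_def [abs_def] using D(1)[OF F that] D(1)[OF G that]
      by (intro has_derivative_add has_derivative_scaleR_left)
    have det_eq: "det (matrix (?f' x)) =
        ?D F x (axis 1 1) * ?D G x (axis 2 1) - ?D F x (axis 2 1) * ?D G x (axis 1 1)" for x
      by (simp only: det_2 matrix_def vec_lambda_beta plane_map_nth)
    have jac: "\<bar>det (matrix (?f' x))\<bar> \<le> W * \<delta>" if "x \<in> ?B" for x
    proof -
      have x: "x \<in> ?S" using that r by auto
      have "det (matrix (?f' x)) = wedge (differential F) (differential G) c (?inv x) (axis 1 1) (axis 2 1)"
        unfolding det_eq by (simp add: wedge_def differential_def coord_inv[OF x])
      also have "\<dots> = poisson_bracket A \<omega> F G (?inv x) * ?w x"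
        using poisson_bracket[OF A \<omega> F G c(1) inv_dom[OF x]] by simp
      finally have "\<bar>det (matrix (?f' x))\<bar> = \<bar>?w x\<bar> * \<bar>poisson_bracket A \<omega> F G (?inv x)\<bar>"
        by (simp add: abs_mult)
      also have "\<dots> \<le> W * \<delta>" using W[OF that] \<delta> \<open>0 \<le> W\<close> by (intro mult_mono) auto
      finally show ?thesis .
    qed
    \<comment> \<open>The centre serves as the point of the ball that \<open>D(2)\<close> asks
      for.\<close>
    have "coord c p \<in> ?B" using r by simp
    then have "continuous_on ?B (\<lambda>x. \<bar>det (matrix (?f' x))\<bar>)"
      unfolding det_eq
      by (intro continuous_on_rabs continuous_on_diff continuous_on_mult D(2)[OF F] D(2)[OF G])
    then have "(\<lambda>x. \<bar>det (matrix (?f' x))\<bar>) \<in> borel_measurable (lebesgue_on ?B)"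
      by (rule continuous_imp_measurable_on_sets_lebesgue) simp
    moreover have "(\<lambda>_. W * \<delta>) integrable_on ?B"
      by (rule integrable_on_const) simp
    ultimately have int: "(\<lambda>x. \<bar>det (matrix (?f' x))\<bar>) integrable_on ?B"
      by (rule measurable_bounded_by_integrable_imp_integrable_real) (use jac in simp_all)
    have meas: "?f ` ?B \<in> lmeasurable" "measure lebesgue (?f ` ?B) \<le> W * \<delta> * measure lebesgue ?B"
      by (rule measurable_bounded_differentiable_image[OF lmeasurable_cball deriv int jac]
          measure_bounded_differentiable_image[OF lmeasurable_cball deriv int jac]; assumption)+
    have "plane_map F G q \<in> ?f ` ?B" if "q \<in> U" for q
    proof (rule image_eqI[of _ _ "coord c q"])
      have "?inv (coord c q) = q" using hom that by (auto simp: homeomorphism_def U_def)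
      then show "plane_map F G q = ?f (coord c q)" by (simp add: plane_map_def)
    qed (use that in \<open>auto simp: U_def\<close>)
    then show ?thesis
      using meas by (intro bexI[of _ "?f ` ?B"]) (auto simp: mult_ac)
  qed
  show thesis
  proof (rule that[of U "W * measure lebesgue ?B"])
    have "continuous_on (dom_chart c) (coord c)" using hom by (simp add: homeomorphism_def)
    then show "open U" unfolding U_def using dom by (intro continuous_open_preimage) auto
    show "p \<in> U" using c r by (simp add: U_def)
    show "0 \<le> W * measure lebesgue ?B" using \<open>0 \<le> W\<close> by simp
    show "bracket_bounds_area A \<omega> U (W * measure lebesgue ?B)"
      unfolding bracket_bounds_area_def using bound by simp
  qed
qed

text \<open>By compactness finitely many of the local neighbourhoods cover the surface, and their
  constants add up.\<close>

lemma image_area_le_bracket: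
  fixes A :: "'a::t2_space chart set"
  assumes A: "closed_surface A" and \<omega>: "area_form A \<omega>"
  obtains C where "0 \<le> C" "bracket_bounds_area A \<omega> UNIV C"
proof -
  have cpt: "compact (UNIV :: 'a set)" and at: "smooth_atlas A" using A by (auto simp: closed_surface_def)
  have "\<exists>U C. open U \<and> p \<in> U \<and> 0 \<le> C \<and> bracket_bounds_area A \<omega> U C" for p
    by (rule local_image_area_le_bracket[OF at \<omega>, of p]) blast
  then have "\<forall>p. \<exists>U C. open U \<and> p \<in> U \<and> 0 \<le> C \<and> bracket_bounds_area A \<omega> U C" ..
  then have "\<exists>U C. \<forall>p. open (U p) \<and> p \<in> U p \<and> 0 \<le> C p \<and> bracket_bounds_area A \<omega> (U p) (C p)"
    unfolding choice_iff .
  then obtain U C where "\<forall>p. open (U p) \<and> p \<in> U p \<and> 0 \<le> C p \<and> bracket_bounds_area A \<omega> (U p) (C p)"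
    by (elim exE)
  then have U: "open (U p)" "p \<in> U p" and C: "0 \<le> C p" and P: "bracket_bounds_area A \<omega> (U p) (C p)" for p
    by (simp_all only: all_conj_distrib)
  obtain T where T: "finite T" "UNIV = (\<Union>p\<in>T. U p)"
  proof (rule compactE_image[OF cpt, of UNIV U])
    show "UNIV \<subseteq> (\<Union>p\<in>UNIV. U p)" using U(2) by blast
    fix T assume "finite T" "UNIV \<subseteq> (\<Union>p\<in>T. U p)"
    then show thesis by (intro that[of T] subset_antisym subset_UNIV)
  qed (rule U(1))
  have bound: "\<exists>K\<in>lmeasurable. range (plane_map F G) \<subseteq> K \<and> measure lebesgue K \<le> (\<Sum>p\<in>T. C p) * \<delta>"
    if "smooth_fun A F" "smooth_fun A G" "\<forall>q. \<bar>poisson_bracket A \<omega> F G q\<bar> \<le> \<delta>" for F G \<delta>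
  proof -
    have "\<exists>K. K \<in> lmeasurable \<and> plane_map F G ` U p \<subseteq> K \<and> measure lebesgue K \<le> C p * \<delta>" for p
      using P[of p, unfolded bracket_bounds_area_def, rule_format, OF that(1,2) that(3)[rule_format]]
      unfolding Bex_def .
    then have "\<forall>p. \<exists>K. K \<in> lmeasurable \<and> plane_map F G ` U p \<subseteq> K \<and> measure lebesgue K \<le> C p * \<delta>" ..
    then obtain K where "\<forall>p. K p \<in> lmeasurable \<and> plane_map F G ` U p \<subseteq> K p \<and> measure lebesgue (K p) \<le> C p * \<delta>"
      unfolding choice_iff ..
    then have K: "K p \<in> lmeasurable" "plane_map F G ` U p \<subseteq> K p" "measure lebesgue (K p) \<le> C p * \<delta>" for p
      by (simp_all only: all_conj_distrib)
    show ?thesis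
    proof (intro bexI conjI)
      show "range (plane_map F G) \<subseteq> (\<Union>p\<in>T. K p)"
      proof
        fix z assume "z \<in> range (plane_map F G)"
        then obtain q where q: "z = plane_map F G q" by (rule imageE)
        obtain p where "p \<in> T" "q \<in> U p" using T(2)[THEN equalityD1] by blast
        then show "z \<in> (\<Union>p\<in>T. K p)" using q K(2)[of p] by blast
      qed
      show "(\<Union>p\<in>T. K p) \<in> lmeasurable" by (intro fmeasurable.finite_UN T(1) K(1))
      have "measure lebesgue (\<Union>p\<in>T. K p) \<le> (\<Sum>p\<in>T. measure lebesgue (K p))"
        by (intro measure_UNION_le T(1) fmeasurableD K(1))
      also have "\<dots> \<le> (\<Sum>p\<in>T. C p) * \<delta>"
        unfolding sum_distrib_right by (intro sum_mono K)
      finally show "measure lebesgue (\<Union>p\<in>T. K p) \<le> (\<Sum>p\<in>T. C p) * \<delta>" .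
    qed
  qed
  show thesis
  proof (rule that[of "\<Sum>p\<in>T. C p"])
    show "0 \<le> (\<Sum>p\<in>T. C p)" using C by (simp add: sum_nonneg)
    show "bracket_bounds_area A \<omega> UNIV (\<Sum>p\<in>T. C p)"
      unfolding bracket_bounds_area_def using bound by simp
  qed
qed

text \<open>Otherwise lattice translates of the image would cover a fundamental square.\<close>

lemma exists_avoiding_scaled_lattice:
  fixes F G :: "'a \<Rightarrow> real" and n :: int
  assumes s: "0 < s" and FR: "\<And>p. \<bar>F p\<bar> \<le> R" and GR: "\<And>p. \<bar>G p\<bar> \<le> R" and n: "R / s + 1 \<le> of_int n"
    and K: "K \<in> lmeasurable" and img: "range (plane_map F G) \<subseteq> K"
    and small: "real (card ({-n..n} \<times> {-n..n})) * measure lebesgue K < s\<^sup>2"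
  shows "\<exists>\<alpha> \<beta>. \<forall>p. \<not> ((F p - \<alpha>) / s \<in> \<int> \<and> (G p - \<beta>) / s \<in> \<int>)"
proof (rule ccontr)
  assume neg: "\<not> ?thesis"
  define T where "T = {-n..n} \<times> {-n..n}"
  have T: "finite T" by (simp add: T_def)
  \<comment> \<open>If \<open>(F p, G p)\<close> differs from an offset by the lattice vector
    \<open>s * (i, j)\<close>, translation by \<open>v (i, j)\<close> takes it back to that
    offset.\<close>
  define v :: "int \<times> int \<Rightarrow> real^2" where "v = (\<lambda>(i, j). vector [- (s * of_int i), - (s * of_int j)])"
  let ?Q = "cbox 0 (vector [s, s]) :: (real^2) set"
  have "?Q \<subseteq> (\<Union>t\<in>T. (+) (v t) ` K)"
  proof
    fix z assume "z \<in> ?Q"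
    then have z: "0 \<le> z$1" "z$1 \<le> s" "0 \<le> z$2" "z$2 \<le> s"
      by (auto simp: mem_box_cart forall_2)
    \<comment> \<open>The point \<open>z\<close> is itself used as the offset
      \<open>(\<alpha>, \<beta>)\<close> in \<open>neg\<close>.\<close>
    obtain p i j where p: "(F p - z$1) / s = of_int i" "(G p - z$2) / s = of_int j"
    proof -
      obtain p where "(F p - z$1) / s \<in> \<int>" "(G p - z$2) / s \<in> \<int>" using neg by blast
      then show thesis using that by (elim Ints_cases)
    qed
    \<comment> \<open>Here \<open>s * k = a - b\<close> has size at most \<open>R + s\<close>, so
      \<open>n\<close> bounds the index.\<close>
    have bound: "k \<in> {-n..n}" if "\<bar>a\<bar> \<le> R" "0 \<le> b" "b \<le> s" "(a - b) / s = of_int k" for a b k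
    proof -
      have "\<bar>real_of_int k\<bar> = \<bar>a - b\<bar> / s" using s by (simp flip: that(4))
      also have "\<dots> \<le> (R + s) / s" using that s by (intro divide_right_mono) auto
      also have "\<dots> = R / s + 1" using s by (simp add: add_divide_distrib)
      also have "\<dots> \<le> real_of_int n" by (rule n)
      finally have "\<bar>k\<bar> \<le> n" by linarith
      then show ?thesis by auto
    qed
    have "(i, j) \<in> T"
      unfolding T_def using bound[OF FR z(1,2) p(1)] bound[OF GR z(3,4) p(2)] by blast
    moreover have "z = v (i, j) + plane_map F G p"
      using p s by (simp add: v_def vec_eq_iff forall_2 field_simps)
    ultimately show "z \<in> (\<Union>t\<in>T. (+) (v t) ` K)" using img by blast
  qed
  then have "measure lebesgue ?Q \<le> measure lebesgue (\<Union>t\<in>T. (+) (v t) ` K)"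
    using T K by (intro measure_mono_fmeasurable fmeasurable.finite_UN measurable_translation) auto
  also have "\<dots> \<le> (\<Sum>t\<in>T. measure lebesgue ((+) (v t) ` K))"
    using T K by (intro measure_UNION_le) (auto intro: measurable_translation fmeasurableD)
  also have "\<dots> = card T * measure lebesgue K" by (simp add: measure_translation)
  finally have "measure lebesgue ?Q < s\<^sup>2" using small by (simp add: T_def)
  moreover have "measure lebesgue ?Q = s\<^sup>2"
    using s by (simp add: content_cbox_cart interval_ne_empty_cart forall_2 UNIV_2 power2_eq_square)
  ultimately show False by simp
qed

section \<open>From small brackets to additivity\<close>

context compact_quasi_state
begin

text \<open>The smallness conditions involve only constants, so they can be arranged before a pair
  of approximants is chosen.\<close>

lemma E_add_of_small_bracket:
  fixes n :: int
  assumes C: "bracket_bounds_area A \<omega> UNIV C"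
    and s: "0 < s" and n: "R / s + 1 \<le> of_int n" and small: "real (card ({-n..n} \<times> {-n..n})) * (C * \<delta>) < s\<^sup>2"
    and F: "continuous_on UNIV F" "smooth_fun A F" "\<And>p. \<bar>F p\<bar> \<le> R"
    and G: "continuous_on UNIV G" "smooth_fun A G" "\<And>p. \<bar>G p\<bar> \<le> R"
    and bracket: "\<And>p. \<bar>poisson_bracket A \<omega> F G p\<bar> \<le> \<delta>"
  shows "\<bar>E (\<lambda>p. F p + G p) - E F - E G\<bar> \<le> 2 * s"
proof -
  obtain K where K: "K \<in> lmeasurable" "range (plane_map F G) \<subseteq> K" "measure lebesgue K \<le> C * \<delta>"
    using C[unfolded bracket_bounds_area_def, rule_format, OF F(2) G(2) bracket] by (elim bexE conjE)
  have "real (card ({-n..n} \<times> {-n..n})) * measure lebesgue K \<le> real (card ({-n..n} \<times> {-n..n})) * (C * \<delta>)"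
    using K(3) by (rule mult_left_mono) simp
  then have "real (card ({-n..n} \<times> {-n..n})) * measure lebesgue K < s\<^sup>2"
    using small by linarith
  from exists_avoiding_scaled_lattice[OF s F(3) G(3) n K(1,2) this]
  obtain \<alpha> \<beta> where avoid: "\<forall>p. \<not> ((F p - \<alpha>) / s \<in> \<int> \<and> (G p - \<beta>) / s \<in> \<int>)"
    by (elim exE)
  show ?thesis
    by (rule E_add_avoiding_scaled_lattice[OF F(1) G(1) s avoid[rule_format]])
qed

text \<open>The estimate for smooth approximants passes to the limit because \<open>\<eta>\<close>
  is 1-Lipschitz in the uniform norm.\<close>

lemma poisson_commute_imp_add:
  assumes A: "closed_surface A" and \<omega>: "area_form A \<omega>" and FG: "poisson_commute A \<omega> F G"
  shows "\<eta> (F + G) = \<eta> F + \<eta> G"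
proof -
  obtain Fs Gs where smooth: "\<And>k. smooth_fun A (apply_bcontfun (Fs k))" "\<And>k. smooth_fun A (apply_bcontfun (Gs k))"
    and lims: "Fs \<longlonglongrightarrow> F" "Gs \<longlonglongrightarrow> G"
    and bracket: "uniform_limit UNIV
      (\<lambda>k. poisson_bracket A \<omega> (apply_bcontfun (Fs k)) (apply_bcontfun (Gs k))) (\<lambda>_. 0) sequentially"
    using FG unfolding poisson_commute_def by blast
  have "Bseq Fs" "Bseq Gs" using lims by (auto intro: convergent_imp_Bseq convergentI)
  then obtain RF RG where RF: "\<And>k. norm (Fs k) \<le> RF" and RG: "\<And>k. norm (Gs k) \<le> RG"
    unfolding Bseq_def by blast
  \<comment> \<open>One bound for both sequences allows \<open>n\<close> and \<open>\<delta>\<close>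
    to be fixed before \<open>k\<close>.\<close>
  define R where "R = max RF RG"
  have R: "\<bar>apply_bcontfun (Fs k) p\<bar> \<le> R" "\<bar>apply_bcontfun (Gs k) p\<bar> \<le> R" for k p
    using norm_bounded[of "Fs k" p] norm_bounded[of "Gs k" p] RF[of k] RG[of k] by (auto simp: R_def)
  have lip: "\<bar>\<eta> H - \<eta> H'\<bar> \<le> dist H H'" for H H'
    using E_lipschitz[of "apply_bcontfun H" "apply_bcontfun H'"] dist_bounded[of H _ H']
    by (simp add: E_apply_bcontfun dist_real_def)
  obtain C where C: "0 \<le> C" "bracket_bounds_area A \<omega> UNIV C"
    by (rule image_area_le_bracket[OF A \<omega>])
  have "\<bar>\<eta> (F + G) - \<eta> F - \<eta> G\<bar> \<le> 0 + e" if e: "0 < e" for e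
  proof -
    \<comment> \<open>The error is \<open>2 * s\<close> for the approximants, \<open>s\<close> for
      each limit and \<open>2 * s\<close> for the limit of the sum.\<close>
    define s where "s = e / 6"
    have s: "0 < s" using e by (simp add: s_def)
    obtain n :: int where n: "R / s + 1 \<le> of_int n" using ex_le_of_int by blast
    define N where "N = real (card ({-n..n} \<times> {-n..n}))"
    \<comment> \<open>The summand 1 keeps the denominator positive and makes
      \<open>N * (C * \<delta>) < s\<^sup>2\<close> strict.\<close>
    define \<delta> where "\<delta> = s\<^sup>2 / (N * C + 1)"
    have NC: "0 \<le> N * C" using C(1) by (simp add: N_def)
    then have "0 < N * C + 1" by linarith
    then have \<delta>: "0 < \<delta>" "(N * C + 1) * \<delta> = s\<^sup>2" using s by (simp_all add: \<delta>_def)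
    then have small: "N * (C * \<delta>) < s\<^sup>2" by (simp add: distrib_right mult.assoc)
    have "\<forall>\<^sub>F k in sequentially. dist (Fs k) F < s \<and> dist (Gs k) G < s \<and>
        (\<forall>p\<in>UNIV. dist (poisson_bracket A \<omega> (apply_bcontfun (Fs k)) (apply_bcontfun (Gs k)) p) 0 < \<delta>)"
      using tendstoD[OF lims(1) s] tendstoD[OF lims(2) s] uniform_limitD[OF bracket \<delta>(1)]
      by (intro eventually_conj)
    from eventually_happens'[OF sequentially_bot this]
    obtain k where k: "dist (Fs k) F < s" "dist (Gs k) G < s"
      and "\<forall>p\<in>UNIV. dist (poisson_bracket A \<omega> (apply_bcontfun (Fs k)) (apply_bcontfun (Gs k)) p) 0 < \<delta>"
      by blast
    then have \<delta>k: "\<bar>poisson_bracket A \<omega> (apply_bcontfun (Fs k)) (apply_bcontfun (Gs k)) p\<bar> \<le> \<delta>" for p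
      by (simp add: dist_real_def less_imp_le)
    have "\<bar>E (\<lambda>p. Fs k p + Gs k p) - E (Fs k) - E (Gs k)\<bar> \<le> 2 * s"
      by (rule E_add_of_small_bracket[OF C(2) s n small[unfolded N_def]]) (use smooth R \<delta>k in auto)
    moreover have "E (\<lambda>p. Fs k p + Gs k p) = \<eta> (Fs k + Gs k)"
      using E_apply_bcontfun[of "Fs k + Gs k"] by (simp add: plus_bcontfun.rep_eq)
    ultimately have "\<bar>\<eta> (Fs k + Gs k) - \<eta> (Fs k) - \<eta> (Gs k)\<bar> \<le> 2 * s"
      by (simp add: E_apply_bcontfun)
    moreover have "dist (Fs k + Gs k) (F + G) \<le> dist (Fs k) F + dist (Gs k) G"
      by (rule dist_triangle_add)
    ultimately show ?thesis
      using k lip[of "Fs k" F] lip[of "Gs k" G] lip[of "Fs k + Gs k" "F + G"] unfolding s_def by linarith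
  qed
  then have "\<bar>\<eta> (F + G) - \<eta> F - \<eta> G\<bar> \<le> 0" by (rule field_le_epsilon)
  then show ?thesis by simp
qed

end

theorem corollary1p8:
  fixes A :: "'a::t2_space chart set"
    and \<omega> :: "'a form2"
    and \<eta> :: "('a \<Rightarrow>\<^sub>C real) \<Rightarrow> real"
    and V :: "('a \<Rightarrow>\<^sub>C real) set"
  assumes "closed_surface A"
    and "area_form A \<omega>"
    and "quasi_state \<eta>"
    and "subspace V"
    and "\<And>F G. F \<in> V \<Longrightarrow> G \<in> V \<Longrightarrow> poisson_commute A \<omega> F G"
  shows "linear_on V \<eta>"
proof -
  interpret compact_quasi_state \<eta>
    using assms by unfold_locales (auto simp: closed_surface_def)
  \<comment> \<open>Multiples of \<open>F\<close> lie in the subalgebra generated by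
    \<open>F\<close>, where \<open>\<eta>\<close> is linear.\<close>
  have "\<eta> (a *\<^sub>R F) = a * \<eta> F" for a F
    using E_scale[of "apply_bcontfun F" a] E_apply_bcontfun[of "a *\<^sub>R F"]
    by (simp add: scaleR_bcontfun.rep_eq E_apply_bcontfun)
  then show ?thesis
    unfolding linear_on_def using poisson_commute_imp_add assms by blast
qed

end
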